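(* Let $\ell$ be a prime and let $S$ be a subset of $\mathbb{F}_{\ell}$. Let $n$ be a positive integer. Denote by $N(\ell,S,n)$ the number of solutions $(a,b,c,s,t)$ to the congruence $$as-bt\equiv c\pmod{\ell}$$ with integers $a,b,c$ satisfying $1\le a,b\le n$ and $|c|\le n$, and with $s,t\in S$. Then $$N(\ell,S,n)\ll_{\epsilon}\ell^{-1}n^3|S|^2+\ell^{\epsilon}n^2|S|$$ for any $\epsilon>0$.
   Context: $\mathbb{F}_\ell$ is the field with $\ell$ elements, identified with the residue classes modulo $\ell$, and $|S|$ is the cardinality of $S$. The notation $X\ll_{\epsilon}Y$ means $|X|\le C\,Y$ for a constant $C>0$ depending only on $\epsilon$ (so uniform in $\ell$, $S$ and $n$). *)

theory Defs
  imports Complex_Main "HOL-Number_Theory.Residues"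
begin

text \<open>
  Elements of \<open>F\<^sub>l\<close> are given by their representatives in \<open>carrier (residue_ring l) = {0..l - 1}\<close>.
\<close>

definition solutions :: "nat \<Rightarrow> int set \<Rightarrow> nat \<Rightarrow> (int \<times> int \<times> int \<times> int \<times> int) set" where
  "solutions l S n =
     {(a, b, c, s, t). 1 \<le> a \<and> a \<le> int n \<and> 1 \<le> b \<and> b \<le> int n \<and> \<bar>c\<bar> \<le> int n \<and>
        s \<in> S \<and> t \<in> S \<and> [a * s - b * t = c] (mod int l)}"

definition num_solutions :: "nat \<Rightarrow> int set \<Rightarrow> nat \<Rightarrow> nat" where
  "num_solutions l S n = card (solutions l S n)"

end

theory Submission
  imports Defs "HOL-Analysis.Convex"
begin

text \<open>
  Majorise the condition \<open>\<bar>c\<bar> \<le> n\<close> by a Fejer kernel with frequencies below \<open>K \<approx> l / (6 n)\<close>. The zero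
  frequency gives \<open>n\<^sup>3 |S|\<^sup>2 / l\<close>. At a frequency \<open>h \<noteq> 0\<close> one meets \<open>|\<Sum>\<^sub>a S'(h a)|\<^sup>2\<close>, \<open>S'\<close> being the
  Fourier transform of the indicator function of \<open>S\<close>. By Cauchy-Schwarz this is at most
  \<open>n \<Sum>\<^sub>a |S'(h a)|\<^sup>2\<close>; since the integers \<open>h a\<close> lie below \<open>l\<close>, each one arises at most \<open>l\<^sup>\<epsilon>\<close> times
  by the divisor bound, and Parseval's identity concludes.
\<close>

section \<open>The divisor bound\<close>

text \<open>A divisor of m is determined by its exponents at the primes dividing m, and none exceeds
  the exponent in m. \<open>restrict\<close> makes the exponent vector an element of the extensional
  product, whose cardinality is the right-hand side.\<close>

lemma card_divisors_le_prod:
  fixes m :: nat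
  assumes "m > 0"
  shows "card {d. d dvd m} \<le> (\<Prod>p\<in>prime_factors m. multiplicity p m + 1)"
proof -
  let ?P = "prime_factors m"
  let ?f = "\<lambda>d::nat. restrict (\<lambda>p. multiplicity p d) ?P"
  have "inj_on ?f {d. d dvd m}"
  proof (rule inj_onI)
    fix d e assume de: "d \<in> {d. d dvd m}" "e \<in> {d. d dvd m}" and eq: "?f d = ?f e"
    have nz: "d > 0" "e > 0" using de assms by (auto intro: Nat.gr0I)
    show "d = e"
    proof (rule multiplicity_eq_nat[OF nz])
      fix p :: nat assume p: "prime p"
      show "multiplicity p d = multiplicity p e"
      proof (cases "p \<in> ?P")
        case True
        then show ?thesis using fun_cong[OF eq, of p] by simp
      next
        case False
        then have "\<not> p dvd m" using p assms by (auto simp: prime_factors_dvd)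
        then have "\<not> p dvd d" "\<not> p dvd e" using de by (auto dest: dvd_trans)
        then show ?thesis by (simp add: not_dvd_imp_multiplicity_0)
      qed
    qed
  qed
  moreover have "?f ` {d. d dvd m} \<subseteq> (\<Pi>\<^sub>E p\<in>?P. {..multiplicity p m})"
    using assms by (auto simp: dvd_imp_multiplicity_le)
  moreover have "finite (\<Pi>\<^sub>E p\<in>?P. {..multiplicity p m})"
    by (intro finite_PiE) auto
  ultimately have "card {d. d dvd m} \<le> card (\<Pi>\<^sub>E p\<in>?P. {..multiplicity p m})"
    by (meson card_inj_on_le)
  then show ?thesis by (simp add: card_PiE)
qed

text \<open>With y = \<epsilon> ln 2, the product (1 + 1/y)(1 + y e) already exceeds e + 1, and 1 +
  y e <= exp (y e). This pays for the exponents at small primes.\<close>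

lemma Suc_le_powr_two:
  fixes \<epsilon> :: real
  assumes "\<epsilon> > 0"
  shows "real e + 1 \<le> (1 + 1 / (\<epsilon> * ln 2)) * 2 powr (\<epsilon> * real e)"
proof -
  let ?y = "\<epsilon> * ln 2 :: real"
  have y: "?y > 0" using assms by simp
  have "real e + 1 \<le> (1 + 1 / ?y) * (1 + ?y * real e)"
  proof -
    have "(1 + 1 / ?y) * (1 + ?y * real e) = real e + 1 + (1 / ?y + ?y * real e)"
      using assms by (simp add: ring_distribs)
    moreover have "0 \<le> 1 / ?y + ?y * real e" using y by (intro add_nonneg_nonneg) auto
    ultimately show ?thesis by linarith
  qed
  also have "\<dots> \<le> (1 + 1 / ?y) * exp (?y * real e)"
    using y exp_ge_add_one_self[of "?y * real e"] by (intro mult_left_mono) auto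
  also have "exp (?y * real e) = 2 powr (\<epsilon> * real e)"
    by (simp add: powr_def mult_ac)
  finally show ?thesis .
qed

text \<open>Compare e + 1 with p^(\<epsilon> e) prime by prime. A prime p >= Q has p^\<epsilon> >=
  2, so e + 1 <= 2^e suffices without a constant; each of the at most Q smaller primes costs a
  factor B, hence the constant B^Q.\<close>

lemma divisor_bound:
  fixes \<epsilon> :: real
  assumes "\<epsilon> > 0"
  obtains D where "D > 0" "\<And>m::nat. m > 0 \<Longrightarrow> real (card {d. d dvd m}) \<le> D * real m powr \<epsilon>"
proof -
  define B where "B = 1 + 1 / (\<epsilon> * ln 2)"
  define Q where "Q = nat \<lceil>2 powr (1 / \<epsilon>)\<rceil>"
  have B1: "B \<ge> 1" using assms by (simp add: B_def)
  have local_bound: "real (e + 1) \<le> (if p < Q then B else 1) * (real p ^ e) powr \<epsilon>"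
    if "prime p" for p e :: nat
  proof -
    have p2: "real p \<ge> 2" using prime_ge_2_nat[OF that] by simp
    have pw: "(real p ^ e) powr \<epsilon> = real p powr (\<epsilon> * real e)"
      using p2 by (simp add: powr_realpow[symmetric] powr_powr mult_ac)
    show ?thesis
    proof (cases "p < Q")
      case True
      have "real e + 1 \<le> B * 2 powr (\<epsilon> * real e)"
        unfolding B_def by (rule Suc_le_powr_two[OF assms])
      also have "\<dots> \<le> B * real p powr (\<epsilon> * real e)"
        using p2 B1 assms by (intro mult_left_mono powr_mono2) auto
      finally show ?thesis using True pw by simp
    next
      case False
      then have "2 powr (1 / \<epsilon>) \<le> real p" unfolding Q_def by linarith
      then have "(2 powr (1 / \<epsilon>)) powr \<epsilon> \<le> real p powr \<epsilon>"
        using assms by (intro powr_mono2) auto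
      then have two: "2 \<le> real p powr \<epsilon>" using assms by (simp add: powr_powr)
      have "e + 1 \<le> 2 ^ e" by (induction e) auto
      then have "real (e + 1) \<le> 2 ^ e" by (metis of_nat_le_iff of_nat_numeral of_nat_power)
      also have "\<dots> \<le> (real p powr \<epsilon>) ^ e" using two by (intro power_mono) auto
      also have "\<dots> = real p powr (\<epsilon> * real e)"
        using p2 by (simp add: powr_powr flip: powr_realpow)
      finally show ?thesis using False pw by simp
    qed
  qed
  have "real (card {d. d dvd m}) \<le> B ^ Q * real m powr \<epsilon>" if m: "m > 0" for m :: nat
  proof -
    let ?P = "prime_factors m"
    have "real (card {d. d dvd m}) \<le> real (\<Prod>p\<in>?P. multiplicity p m + 1)"
      using card_divisors_le_prod[OF m] by (simp only: of_nat_le_iff)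
    also have "\<dots> = (\<Prod>p\<in>?P. real (multiplicity p m + 1))" by (rule of_nat_prod)
    also have "\<dots> \<le> (\<Prod>p\<in>?P. (if p < Q then B else 1) * (real p ^ multiplicity p m) powr \<epsilon>)"
      by (intro prod_mono conjI local_bound) auto
    also have "\<dots> = (\<Prod>p\<in>?P. if p < Q then B else 1) * (\<Prod>p\<in>?P. real p ^ multiplicity p m) powr \<epsilon>"
      by (simp add: prod.distrib prod_powr_distrib)
    also have "(\<Prod>p\<in>?P. real p ^ multiplicity p m) = real m"
    proof -
      have "m = (\<Prod>p\<in>?P. p ^ multiplicity p m)"
        using m by (simp add: prod_prime_factors)
      then have "real m = real (\<Prod>p\<in>?P. p ^ multiplicity p m)" by simp
      then show ?thesis by simp
    qed
    also have "(\<Prod>p\<in>?P. if p < Q then B else 1) = B ^ card {p\<in>?P. p < Q}"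
      by (simp add: prod.If_cases Int_def)
    also have "B ^ card {p\<in>?P. p < Q} * real m powr \<epsilon> \<le> B ^ Q * real m powr \<epsilon>"
    proof (intro mult_right_mono power_increasing)
      have "card {p\<in>?P. p < Q} \<le> card {..<Q}" by (intro card_mono) auto
      then show "card {p\<in>?P. p < Q} \<le> Q" by simp
    qed (use B1 in auto)
    finally show ?thesis .
  qed
  moreover have "B ^ Q > 0" using B1 by simp
  ultimately show thesis using that by blast
qed

section \<open>Additive characters\<close>

definition add_char :: "nat \<Rightarrow> int \<Rightarrow> complex" where
  "add_char l x = cis (2 * pi * real_of_int x / real l)"

lemma add_char_0 [simp]: "add_char l 0 = 1"
  by (simp add: add_char_def)

lemma add_char_add: "add_char l (x + y) = add_char l x * add_char l y"
  by (simp add: add_char_def cis_mult ring_distribs add_divide_distrib)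

lemma cnj_add_char: "cnj (add_char l x) = add_char l (- x)"
  by (simp add: add_char_def cis_cnj)

lemma add_char_diff: "add_char l (x - y) = add_char l x * cnj (add_char l y)"
  using add_char_add[of l x "- y"] by (simp add: cnj_add_char)

lemma add_char_power: "add_char l (int k * x) = add_char l x ^ k"
  unfolding add_char_def Complex.DeMoivre by (intro arg_cong[where f = cis]) (simp add: mult_ac)

lemma add_char_multiple: "l > 0 \<Longrightarrow> add_char l (int l * x) = 1"
  using cis_multiple_2pi[of "real_of_int x"] by (simp add: add_char_def mult_ac)

lemma add_char_cong:
  assumes "l > 0" "[x = y] (mod int l)"
  shows "add_char l x = add_char l y"
proof -
  obtain k where "x = y + int l * k"
    using assms(2) by (metis cong_iff_lin cong_sym)
  then show ?thesis using assms(1) by (simp add: add_char_add add_char_multiple)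
qed

lemma add_char_eq_1D:
  assumes "l > 0" "add_char l x = 1"
  shows "int l dvd x"
proof -
  have "cos (2 * pi * real_of_int x / real l) = 1"
    using assms(2) by (simp add: add_char_def complex_eq_iff)
  then obtain k :: int where "2 * pi * real_of_int x / real l = real_of_int k * 2 * pi"
    using cos_one_2pi_int by auto
  then have "real_of_int x = real_of_int (k * int l)"
    using assms(1) by (simp add: field_simps)
  then have "x = k * int l" by (simp only: of_int_eq_iff)
  then show ?thesis by simp
qed

text \<open>Orthogonality: \<open>add_char l x\<close> is an l-th root of unity, and its geometric
  sum vanishes unless the root is 1, that is, unless l divides x.\<close>

lemma sum_add_char:
  assumes "l > 0"
  shows "(\<Sum>m<l. add_char l (int m * x)) = (if int l dvd x then of_nat l else 0)"
proof (cases "int l dvd x")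
  case True
  then have "add_char l x = 1" using add_char_multiple[OF assms] by (auto elim!: dvdE)
  then show ?thesis using True by (simp add: add_char_power)
next
  case False
  then have "add_char l x \<noteq> 1" using add_char_eq_1D[OF assms] by blast
  moreover have "add_char l x ^ l = 1"
    using add_char_multiple[OF assms, of x] by (simp add: add_char_power)
  ultimately have "(\<Sum>m<l. add_char l x ^ m) = 0"
    by (simp add: geometric_sum)
  then show ?thesis using False by (simp add: add_char_power)
qed

text \<open>Expand the square and sum over m first: orthogonality keeps the pairs with s congruent
  to t. As S consists of representatives in one period, these are the diagonal pairs.\<close>

lemma parseval:
  fixes S :: "int set"
  assumes "l > 0" "S \<subseteq> {0..int l - 1}"
  shows "(\<Sum>m<l. (cmod (\<Sum>s\<in>S. add_char l (int m * s)))\<^sup>2) = real l * real (card S)"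
proof -
  have fin: "finite S" using assms(2) by (rule finite_subset) simp
  have iff: "int l dvd s - t \<longleftrightarrow> t = s" if "s \<in> S" "t \<in> S" for s t
  proof
    assume "int l dvd s - t"
    moreover have "s \<in> {0..int l - 1}" "t \<in> {0..int l - 1}" using that assms(2) by blast+
    then have "\<bar>s - t\<bar> < int l" unfolding atLeastAtMost_iff by linarith
    ultimately show "t = s" using dvd_imp_le_int[of "s - t" "int l"] by fastforce
  qed simp
  have "complex_of_real (\<Sum>m<l. (cmod (\<Sum>s\<in>S. add_char l (int m * s)))\<^sup>2)
      = (\<Sum>m<l. (\<Sum>s\<in>S. add_char l (int m * s)) * cnj (\<Sum>s\<in>S. add_char l (int m * s)))"
    by (simp only: of_real_sum complex_norm_square)
  also have "\<dots> = (\<Sum>m<l. \<Sum>s\<in>S. \<Sum>t\<in>S. add_char l (int m * (s - t)))"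
    by (simp add: sum_product right_diff_distrib add_char_diff)
  also have "\<dots> = (\<Sum>s\<in>S. \<Sum>t\<in>S. \<Sum>m<l. add_char l (int m * (s - t)))"
    by (subst sum.swap) (intro sum.cong refl sum.swap)
  also have "\<dots> = (\<Sum>s\<in>S. \<Sum>t\<in>S. if t = s then of_nat l else 0)"
    by (intro sum.cong refl) (simp add: sum_add_char[OF assms(1)] iff)
  also have "\<dots> = complex_of_real (real l * real (card S))"
    using fin by (simp add: sum.delta mult.commute)
  finally show ?thesis by (simp only: of_real_eq_iff)
qed

section \<open>The Fejer kernel and sums over its frequencies\<close>

text \<open>The 6 keeps every angle 2 pi k c / l with k < K within pi/3 of zero, so each term has
  real part at least 1/2 and no cancellation occurs.\<close>

lemma fejer_lower_bound:
  assumes "l > 0" and c: "6 * (int K - 1) * \<bar>c\<bar> \<le> int l"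
  shows "(real K)\<^sup>2 \<le> 4 * (cmod (\<Sum>k<K. add_char l (int k * c)))\<^sup>2"
proof -
  have re: "Re (add_char l (int k * c)) \<ge> 1 / 2" if k: "k < K" for k
  proof -
    let ?\<theta> = "2 * pi * real_of_int (int k * c) / real l"
    have "6 * int k * \<bar>c\<bar> \<le> 6 * (int K - 1) * \<bar>c\<bar>" using k by (intro mult_right_mono) auto
    then have "6 * int k * \<bar>c\<bar> \<le> int l" using c by linarith
    then have "real_of_int (6 * int k * \<bar>c\<bar>) \<le> real_of_int (int l)" by (simp only: of_int_le_iff)
    then have "6 * (real k * \<bar>real_of_int c\<bar>) \<le> real l" by simp
    then have "\<bar>?\<theta>\<bar> \<le> pi / 3"
      using assms(1) by (simp add: abs_mult field_simps)
    then have "cos (pi / 3) \<le> cos \<bar>?\<theta>\<bar>"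
      by (intro cos_monotone_0_pi_le) auto
    then have "1 / 2 \<le> cos ?\<theta>" by (simp only: cos_60 cos_abs_real)
    then show ?thesis by (simp add: add_char_def)
  qed
  have "real K / 2 = (\<Sum>k<K. 1 / 2)" by simp
  also have "\<dots> \<le> (\<Sum>k<K. Re (add_char l (int k * c)))" by (intro sum_mono re) auto
  also have "\<dots> \<le> cmod (\<Sum>k<K. add_char l (int k * c))"
    using complex_Re_le_cmod[of "\<Sum>k<K. add_char l (int k * c)"] by simp
  finally have "(real K / 2)\<^sup>2 \<le> (cmod (\<Sum>k<K. add_char l (int k * c)))\<^sup>2"
    by (intro power_mono) auto
  then show ?thesis by (simp add: power_divide)
qed

text \<open>Both sides expand into the same fourfold sum of \<open>?F k j x y\<close>. The character
  splits over f x - f y, so for fixed k and j the double sum over x and y is a squared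
  modulus.\<close>

lemma sum_fejer_swap:
  fixes f :: "'a \<Rightarrow> int"
  shows "(\<Sum>x\<in>X. \<Sum>y\<in>X. (cmod (\<Sum>k<K. add_char l (int k * (f x - f y))))\<^sup>2)
       = (\<Sum>k<K. \<Sum>j<K. (cmod (\<Sum>x\<in>X. add_char l ((int k - int j) * f x)))\<^sup>2)"
proof -
  let ?F = "\<lambda>k j x y. add_char l ((int k - int j) * (f x - f y))"
  have 1: "complex_of_real ((cmod (\<Sum>k<K. add_char l (int k * (f x - f y))))\<^sup>2)
      = (\<Sum>k<K. \<Sum>j<K. ?F k j x y)" for x y
    by (simp only: complex_norm_square cnj_sum sum_product add_char_diff[symmetric]
        left_diff_distrib)
  have 2: "complex_of_real ((cmod (\<Sum>x\<in>X. add_char l ((int k - int j) * f x)))\<^sup>2)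
      = (\<Sum>x\<in>X. \<Sum>y\<in>X. ?F k j x y)" for k j
    by (simp only: complex_norm_square cnj_sum sum_product add_char_diff[symmetric]
        right_diff_distrib)
  have "(\<Sum>x\<in>X. \<Sum>y\<in>X. \<Sum>k<K. \<Sum>j<K. ?F k j x y)
      = (\<Sum>x\<in>X. \<Sum>k<K. \<Sum>j<K. \<Sum>y\<in>X. ?F k j x y)"
    by (intro sum.cong refl) (subst sum.swap, intro sum.cong refl sum.swap)
  also have "\<dots> = (\<Sum>k<K. \<Sum>j<K. \<Sum>x\<in>X. \<Sum>y\<in>X. ?F k j x y)"
    by (subst sum.swap) (intro sum.cong refl sum.swap)
  finally have "complex_of_real (\<Sum>x\<in>X. \<Sum>y\<in>X. (cmod (\<Sum>k<K. add_char l (int k * (f x - f y))))\<^sup>2)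
      = complex_of_real (\<Sum>k<K. \<Sum>j<K. (cmod (\<Sum>x\<in>X. add_char l ((int k - int j) * f x)))\<^sup>2)"
    by (simp only: of_real_sum 1 2)
  then show ?thesis by (simp only: of_real_eq_iff)
qed

text \<open>In row k the entries with j < k have differences 1, ..., k, and those with j > k have
  differences -1, ..., -(K - 1 - k). By evenness and nonnegativity each side is at most the full sum
  over 1 <= h < K.\<close>

lemma sum_differences_le:
  fixes g :: "int \<Rightarrow> real"
  assumes nonneg: "\<And>h. g h \<ge> 0" and even: "\<And>h. g (- h) = g h"
  shows "(\<Sum>k<K. \<Sum>j<K. g (int k - int j)) \<le> real K * (g 0 + 2 * (\<Sum>h\<in>{1..<K}. g (int h)))"
proof -
  let ?G = "\<Sum>h\<in>{1..<K}. g (int h)"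
  have "(\<Sum>j<K. g (int k - int j)) \<le> g 0 + 2 * ?G" if k: "k < K" for k
  proof -
    have "{..<K} = insert k ({..<k} \<union> {Suc k..<K})" using k by auto
    then have "(\<Sum>j<K. g (int k - int j))
        = g 0 + (\<Sum>j\<in>{..<k} \<union> {Suc k..<K}. g (int k - int j))"
      by simp
    also have "(\<Sum>j\<in>{..<k} \<union> {Suc k..<K}. g (int k - int j))
        = (\<Sum>j<k. g (int k - int j)) + (\<Sum>j\<in>{Suc k..<K}. g (int k - int j))"
      by (rule sum.union_disjoint) auto
    also have "(\<Sum>j<k. g (int k - int j)) = (\<Sum>h\<in>{1..k}. g (int h))"
      by (rule sum.reindex_bij_witness[of _ "\<lambda>h. k - h" "\<lambda>j. k - j"]) auto
    also have "(\<Sum>h\<in>{1..k}. g (int h)) \<le> ?G"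
      using k by (intro sum_mono2 nonneg) auto
    also have "(\<Sum>j\<in>{Suc k..<K}. g (int k - int j)) = (\<Sum>j\<in>{Suc k..<K}. g (int j - int k))"
      using even[of "int k - int j" for j] by simp
    also have "(\<Sum>j\<in>{Suc k..<K}. g (int j - int k)) = (\<Sum>h\<in>{1..<K - k}. g (int h))"
      by (rule sum.reindex_bij_witness[of _ "\<lambda>h. k + h" "\<lambda>j. j - k"]) auto
    also have "(\<Sum>h\<in>{1..<K - k}. g (int h)) \<le> ?G"
      by (intro sum_mono2 nonneg) auto
    finally show ?thesis by simp
  qed
  then have "(\<Sum>k<K. \<Sum>j<K. g (int k - int j)) \<le> (\<Sum>k<K. g 0 + 2 * ?G)"
    by (intro sum_mono) auto
  then show ?thesis by simp
qed

text \<open>Group the pairs by their product m. A pair with product m > 0 is determined by its first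
  factor, a divisor of m, so each F m is counted at most D times.\<close>

lemma sum_products_le:
  fixes F :: "nat \<Rightarrow> real"
  assumes nonneg: "\<And>m. F m \<ge> 0"
    and prod: "\<And>h a. h \<in> A \<Longrightarrow> a \<in> B \<Longrightarrow> 0 < h * a \<and> h * a < l"
    and fin: "finite A" "finite B"
    and D: "\<And>m. 0 < m \<Longrightarrow> m < l \<Longrightarrow> real (card {d. d dvd m}) \<le> D"
    and "D \<ge> 0"
  shows "(\<Sum>h\<in>A. \<Sum>a\<in>B. F (h * a)) \<le> D * (\<Sum>m<l. F m)"
proof -
  let ?X = "\<lambda>m. {z \<in> A \<times> B. fst z * snd z = m}"
  have card: "real (card (?X m)) \<le> D" if "m < l" for m
  proof (cases "m = 0")
    \<comment> \<open>Zero has infinitely many divisors, so the divisor bound says nothing here; the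
      fiber is empty because all products are positive.\<close>
    case True
    have "fst z * snd z \<noteq> m" if "z \<in> A \<times> B" for z
      using prod[of "fst z" "snd z"] that True by (metis less_irrefl mem_Times_iff)
    then have "?X m = {}" by blast
    show ?thesis using \<open>D \<ge> 0\<close> by (simp only: \<open>?X m = {}\<close> card.empty of_nat_0)
  next
    case False
    have "inj_on fst (?X m)"
      using False by (auto intro!: inj_onI)
    moreover have "fst ` ?X m \<subseteq> {d. d dvd m}" by auto
    moreover have "finite {d. d dvd m}" using False by simp
    ultimately have "card (?X m) \<le> card {d. d dvd m}" by (rule card_inj_on_le)
    then show ?thesis using D[of m] False that by linarith
  qed
  have "(\<Sum>h\<in>A. \<Sum>a\<in>B. F (h * a)) = (\<Sum>z\<in>A \<times> B. F (fst z * snd z))"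
    by (simp add: sum.cartesian_product case_prod_beta)
  also have "\<dots> = (\<Sum>m<l. \<Sum>z\<in>?X m. F (fst z * snd z))"
    using fin prod by (intro sum.group[symmetric]) auto
  also have "\<dots> = (\<Sum>m<l. real (card (?X m)) * F m)" by simp
  also have "\<dots> \<le> (\<Sum>m<l. D * F m)"
    by (intro sum_mono mult_right_mono card nonneg) auto
  finally show ?thesis by (simp add: sum_distrib_left)
qed

section \<open>Counting solutions\<close>

text \<open>For 2 n < l a solution is determined by the pairs (a, s) and (b, t). Four times the
  kernel is at least K^2 at each solution and nonnegative elsewhere, so the sum may be extended to
  all pairs.\<close>

lemma num_solutions_le_fejer:
  fixes S :: "int set"
  assumes fin: "finite S" and n: "2 * n < l" and K: "6 * (K - 1) * n \<le> l" "K > 0"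
  shows "(real K)\<^sup>2 * real (num_solutions l S n) \<le>
    4 * (\<Sum>x\<in>{1..n} \<times> S. \<Sum>y\<in>{1..n} \<times> S.
      (cmod (\<Sum>k<K. add_char l (int k * (int (fst x) * snd x - int (fst y) * snd y))))\<^sup>2)"
proof -
  let ?X = "{1..n} \<times> S"
  let ?W = "\<lambda>z. (cmod (\<Sum>k<K. add_char l (int k * (int (fst (fst z)) * snd (fst z)
    - int (fst (snd z)) * snd (snd z)))))\<^sup>2"
  \<comment> \<open>Forgets c. \<open>nat\<close> loses nothing since a, b >= 1, and it lets the
    later frequencies h a be natural numbers.\<close>
  define \<phi> :: "int \<times> int \<times> int \<times> int \<times> int \<Rightarrow> (nat \<times> int) \<times> (nat \<times> int)"
    where "\<phi> = (\<lambda>(a, b, c, s, t). ((nat a, s), (nat b, t)))"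
  have l: "l > 0" using n by simp
  have inj: "inj_on \<phi> (solutions l S n)"
  proof (rule inj_onI)
    fix u v assume uv: "u \<in> solutions l S n" "v \<in> solutions l S n" and eq: "\<phi> u = \<phi> v"
    obtain a b c s t where u: "u = (a, b, c, s, t)" by (cases u) auto
    obtain a' b' c' s' t' where v: "v = (a', b', c', s', t')" by (cases v) auto
    have same: "a = a'" "b = b'" "s = s'" "t = t'"
      using uv eq by (auto simp: u v \<phi>_def solutions_def)
    have "[a' * s' - b' * t' = c] (mod int l)" "[a' * s' - b' * t' = c'] (mod int l)"
      using uv by (simp_all add: u v solutions_def same)
    then have "[c = c'] (mod int l)" by (rule cong_trans[OF cong_sym])
    then have "int l dvd c - c'" by (simp add: cong_iff_dvd_diff)
    \<comment> \<open>Two admissible values of c differ by at most 2 n.\<close>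
    moreover have "\<bar>c - c'\<bar> < int l" using uv n by (auto simp: u v solutions_def)
    ultimately have "c = c'" using dvd_imp_le_int[of "c - c'" "int l"] by fastforce
    then show "u = v" using same u v by simp
  qed
  have sub: "\<phi> ` solutions l S n \<subseteq> ?X \<times> ?X"
    by (auto simp: \<phi>_def solutions_def)
  have big: "(real K)\<^sup>2 \<le> 4 * ?W z" if z: "z \<in> \<phi> ` solutions l S n" for z
  proof -
    obtain a b c s t where u: "(a, b, c, s, t) \<in> solutions l S n" and z: "z = ((nat a, s), (nat b, t))"
      using z by (auto simp: \<phi>_def)
    have cong: "[a * s - b * t = c] (mod int l)" and c: "\<bar>c\<bar> \<le> int n" and ab: "a \<ge> 1" "b \<ge> 1"
      using u by (auto simp: solutions_def)
    have "6 * (int K - 1) * \<bar>c\<bar> \<le> 6 * (int K - 1) * int n"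
      using c K(2) by (intro mult_left_mono) auto
    also have "\<dots> = int (6 * (K - 1) * n)" using K(2) by (simp add: of_nat_diff)
    also have "\<dots> \<le> int l" using K(1) by (simp only: of_nat_le_iff)
    finally have "(real K)\<^sup>2 \<le> 4 * (cmod (\<Sum>k<K. add_char l (int k * c)))\<^sup>2"
      by (rule fejer_lower_bound[OF l])
    \<comment> \<open>The kernel sees only residues, so c may be replaced by a s - b t.\<close>
    also have "(\<Sum>k<K. add_char l (int k * c)) = (\<Sum>k<K. add_char l (int k * (a * s - b * t)))"
      by (intro sum.cong refl add_char_cong[OF l] cong_scalar_left cong_sym[OF cong])
    finally show ?thesis using ab by (simp add: z)
  qed
  have "(real K)\<^sup>2 * real (num_solutions l S n) = (\<Sum>z\<in>\<phi> ` solutions l S n. (real K)\<^sup>2)"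
    using card_image[OF inj] by (simp add: num_solutions_def)
  also have "\<dots> \<le> (\<Sum>z\<in>\<phi> ` solutions l S n. 4 * ?W z)" by (intro sum_mono big)
  also have "\<dots> \<le> (\<Sum>z\<in>?X \<times> ?X. 4 * ?W z)"
    using sub fin by (intro sum_mono2) auto
  also have "\<dots> = 4 * (\<Sum>x\<in>?X. \<Sum>y\<in>?X. ?W (x, y))"
    by (simp only: sum_distrib_left[symmetric] sum.cartesian_product case_prod_unfold prod.collapse)
  finally show ?thesis by simp
qed

text \<open>Trivial count: a, b, s, t are free and fix c modulo l, which leaves at most 2 (n div l)
  + 2 values of c. This has the order n / l of the main term because l <= 2 n.\<close>

lemma num_solutions_le_small_modulus:
  fixes S :: "int set"
  assumes fin: "finite S" and l: "l > 0" "l \<le> 2 * n"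
  shows "real (num_solutions l S n) \<le> 6 * (real n ^ 3 * real (card S) ^ 2 / real l)"
proof -
  \<comment> \<open>The residue of c is known from the other entries, so its quotient by l recovers
    it.\<close>
  define \<phi> :: "int \<times> int \<times> int \<times> int \<times> int \<Rightarrow> int \<times> int \<times> int \<times> int \<times> int"
    where "\<phi> = (\<lambda>(a, b, c, s, t). (a, b, c div int l, s, t))"
  let ?q = "int (n div l)"
  let ?R = "{1..int n} \<times> {1..int n} \<times> {- ?q - 1..?q} \<times> S \<times> S"
  have inj: "inj_on \<phi> (solutions l S n)"
  proof (rule inj_onI)
    fix u v assume uv: "u \<in> solutions l S n" "v \<in> solutions l S n" and eq: "\<phi> u = \<phi> v"
    obtain a b c s t where u: "u = (a, b, c, s, t)" by (cases u) auto
    obtain a' b' c' s' t' where v: "v = (a', b', c', s', t')" by (cases v) auto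
    have same: "a = a'" "b = b'" "s = s'" "t = t'" and d: "c div int l = c' div int l"
      using eq by (auto simp: u v \<phi>_def)
    have "[a' * s' - b' * t' = c] (mod int l)" "[a' * s' - b' * t' = c'] (mod int l)"
      using uv by (simp_all add: u v solutions_def same)
    then have "[c = c'] (mod int l)" by (rule cong_trans[OF cong_sym])
    then have "c mod int l = c' mod int l" by (simp only: Cong.cong_def)
    then have "c = c'" using d by (metis mult_div_mod_eq)
    then show "u = v" using same u v by simp
  qed
  have bounds: "- ?q - 1 \<le> c div int l" "c div int l \<le> ?q" if "\<bar>c\<bar> \<le> int n" for c
  proof -
    have q: "?q = int n div int l" by (simp add: zdiv_int)
    show "c div int l \<le> ?q" unfolding q using that l by (intro zdiv_mono1) auto
    have "(- int n) div int l \<le> c div int l" using that l by (intro zdiv_mono1) auto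
    \<comment> \<open>Floor division of -n rounds downwards, hence the extra -1 when l does not
      divide n.\<close>
    moreover have "- ?q - 1 \<le> (- int n) div int l"
      unfolding q by (simp add: zdiv_zminus1_eq_if l)
    ultimately show "- ?q - 1 \<le> c div int l" by linarith
  qed
  have "\<phi> ` solutions l S n \<subseteq> ?R"
    using bounds by (auto simp: \<phi>_def solutions_def)
  moreover have "finite ?R" using fin by simp
  ultimately have "num_solutions l S n \<le> card ?R"
    unfolding num_solutions_def using inj by (meson card_inj_on_le)
  also have "card ?R = n\<^sup>2 * (card S)\<^sup>2 * (2 * (n div l) + 2)"
  proof -
    have "card {- ?q - 1..?q} = 2 * (n div l) + 2"
      unfolding card_atLeastAtMost_int by linarith
    then show ?thesis by (simp add: card_cartesian_product power2_eq_square algebra_simps)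
  qed
  finally have N: "real (num_solutions l S n) \<le> real (n\<^sup>2 * (card S)\<^sup>2 * (2 * (n div l) + 2))"
    by (simp only: of_nat_le_iff)
  have "real (n div l) \<le> real n / real l" by (rule of_nat_div_le_of_nat)
  \<comment> \<open>The additive 2 is absorbed as 4 n / l, giving the constant 2 + 4 = 6.\<close>
  moreover have "1 \<le> 2 * (real n / real l)" using l by (simp add: field_simps)
  ultimately have "2 * real (n div l) + 2 \<le> 6 * (real n / real l)" by linarith
  then have "(real n)\<^sup>2 * (real (card S))\<^sup>2 * (2 * real (n div l) + 2)
      \<le> (real n)\<^sup>2 * (real (card S))\<^sup>2 * (6 * (real n / real l))"
    by (intro mult_left_mono) auto
  then show ?thesis using N by (simp add: power2_eq_square power3_eq_cube algebra_simps)
qed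

lemma num_solutions_le_large_modulus:
  fixes S :: "int set" and D :: real
  assumes S: "S \<subseteq> {0..int l - 1}" and n: "n > 0" "2 * n < l"
    and D: "\<And>m. 0 < m \<Longrightarrow> m < l \<Longrightarrow> real (card {d. d dvd m}) \<le> D" and "D \<ge> 0"
  shows "real (num_solutions l S n) \<le>
    24 * (real n ^ 3 * real (card S) ^ 2 / real l) + 48 * D * real n ^ 2 * real (card S)"
proof -
  \<comment> \<open>K - 1 is the largest integer with 6 (K - 1) n <= l, as the kernel bound demands;
    K itself exceeds l / (6 n), so dividing by K costs at most 6 n / l.\<close>
  define K where "K = l div (6 * n) + 1"
  have K0: "K > 0" by (simp add: K_def)
  have K1: "6 * (K - 1) * n \<le> l" by (simp add: K_def) (metis div_times_less_eq_dividend mult.assoc mult.commute)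
  have K2: "real l \<le> 6 * real n * real K"
  proof -
    have "l < 6 * n * K" unfolding K_def using n dividend_less_times_div[of "6 * n" l] by simp
    then have "real l \<le> real (6 * n * K)" by (simp only: of_nat_le_iff)
    then show ?thesis by simp
  qed
  have l: "l > 0" using n by simp
  have fin: "finite S" using S by (rule finite_subset) simp
  \<comment> \<open>\<open>T m\<close> is the squared size of the Fourier coefficient of S at m.
    Below, \<open>g h\<close> is that of the family a s, whose coefficient at h is the sum over a of
    those of S at h a.\<close>
  define T where "T m = (cmod (\<Sum>s\<in>S. add_char l (int m * s)))\<^sup>2" for m :: nat
  define g where "g h = (cmod (\<Sum>x\<in>{1..n} \<times> S. add_char l (h * (int (fst x) * snd x))))\<^sup>2" for h :: int
  have g0: "g 0 = (real n * real (card S))\<^sup>2"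
    by (simp add: g_def norm_mult card_cartesian_product)
  have g_even: "g (- h) = g h" for h
  proof -
    have "(\<Sum>x\<in>{1..n} \<times> S. add_char l (- h * (int (fst x) * snd x)))
        = cnj (\<Sum>x\<in>{1..n} \<times> S. add_char l (h * (int (fst x) * snd x)))"
      by (simp add: cnj_add_char)
    then show ?thesis unfolding g_def by (simp only: complex_mod_cnj)
  qed
  have g_le: "g (int h) \<le> real n * (\<Sum>a\<in>{1..n}. T (h * a))" for h
  proof -
    have "(\<Sum>x\<in>{1..n} \<times> S. add_char l (int h * (int (fst x) * snd x)))
        = (\<Sum>a\<in>{1..n}. \<Sum>s\<in>S. add_char l (int (h * a) * s))"
      by (simp add: sum.cartesian_product case_prod_beta mult_ac)
    then have "g (int h) \<le> (\<Sum>a\<in>{1..n}. cmod (\<Sum>s\<in>S. add_char l (int (h * a) * s)))\<^sup>2"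
      unfolding g_def by (intro power_mono) (simp_all only: norm_sum norm_ge_zero)
    \<comment> \<open>Cauchy-Schwarz over a.\<close>
    also have "\<dots> \<le> (\<Sum>a\<in>{1..n}. T (h * a)) * real (card {1..n})"
      unfolding T_def by (rule sum_squared_le_sum_of_squares)
    finally show ?thesis by (simp add: mult.commute)
  qed
  \<comment> \<open>Since h <= K - 1 and a <= n, the product is at most l / 6: there is no
    wrap-around modulo l, so the divisor bound for integers applies.\<close>
  have prod: "0 < h * a \<and> h * a < l" if "h \<in> {1..<K}" "a \<in> {1..n}" for h a
  proof -
    have "h * a \<le> (K - 1) * n" using that by (intro mult_mono) auto
    then have "6 * (h * a) \<le> l" using K1 by (simp add: mult.assoc)
    moreover have "0 < h * a" using that by simp
    ultimately show ?thesis by linarith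
  qed
  have "(\<Sum>h\<in>{1..<K}. g (int h)) \<le> (\<Sum>h\<in>{1..<K}. real n * (\<Sum>a\<in>{1..n}. T (h * a)))"
    by (intro sum_mono g_le)
  also have "\<dots> = real n * (\<Sum>h\<in>{1..<K}. \<Sum>a\<in>{1..n}. T (h * a))"
    by (simp only: sum_distrib_left)
  also have "\<dots> \<le> real n * (D * (\<Sum>m<l. T m))"
    using \<open>D \<ge> 0\<close> by (intro mult_left_mono sum_products_le prod D) (auto simp: T_def)
  also have "(\<Sum>m<l. T m) = real l * real (card S)"
    unfolding T_def by (rule parseval[OF l S])
  finally have offdiag: "(\<Sum>h\<in>{1..<K}. g (int h)) \<le> real n * (D * (real l * real (card S)))" .
  have "(real K)\<^sup>2 * real (num_solutions l S n) \<le> 4 * (\<Sum>k<K. \<Sum>j<K. g (int k - int j))"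
    using num_solutions_le_fejer[OF fin n(2) K1 K0] unfolding g_def
    by (subst (asm) sum_fejer_swap[where f = "\<lambda>x. int (fst x) * snd x"])
  also have "(\<Sum>k<K. \<Sum>j<K. g (int k - int j)) \<le> real K * (g 0 + 2 * (\<Sum>h\<in>{1..<K}. g (int h)))"
    using g_even by (intro sum_differences_le) (auto simp: g_def)
  also have "\<dots> \<le> real K * ((real n * real (card S))\<^sup>2 + 2 * (real n * (D * (real l * real (card S)))))"
    using offdiag by (intro mult_left_mono) (auto simp: g0)
  finally have "real K * (real K * real (num_solutions l S n))
      \<le> real K * (4 * (real n * real (card S))\<^sup>2 + 8 * (real n * D * real l * real (card S)))"
    by (simp add: power2_eq_square algebra_simps)
  \<comment> \<open>One of the two factors K cancels, as each frequency difference occurs at most K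
    times among the pairs (k, j).\<close>
  then have KN: "real K * real (num_solutions l S n)
      \<le> 4 * (real n * real (card S))\<^sup>2 + 8 * (real n * D * real l * real (card S))"
    using K0 by simp
  have "real l * real (num_solutions l S n) \<le> 6 * real n * (real K * real (num_solutions l S n))"
    using mult_right_mono[OF K2, of "real (num_solutions l S n)"] by (simp add: mult_ac)
  also have "\<dots> \<le> 6 * real n * (4 * (real n * real (card S))\<^sup>2 + 8 * (real n * D * real l * real (card S)))"
    using KN by (intro mult_left_mono) auto
  finally show ?thesis
    using l by (simp add: field_simps power2_eq_square power3_eq_cube)
qed

theorem proposition1p3:
  fixes \<epsilon> :: real
  assumes "\<epsilon> > 0"
  shows "\<exists>C>0. \<forall>(l::nat) (S::int set) (n::nat).
           prime l \<longrightarrow> S \<subseteq> carrier (residue_ring (int l)) \<longrightarrow> n > 0 \<longrightarrow>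
           real (num_solutions l S n) \<le>
             C * (real n ^ 3 * real (card S) ^ 2 / real l
                  + real l powr \<epsilon> * real n ^ 2 * real (card S))"
proof -
  obtain D where D0: "D > 0"
    and D: "\<And>m::nat. m > 0 \<Longrightarrow> real (card {d. d dvd m}) \<le> D * real m powr \<epsilon>"
    using divisor_bound[OF assms] by blast
  have "real (num_solutions l S n) \<le> (24 + 48 * D) * (real n ^ 3 * real (card S) ^ 2 / real l
      + real l powr \<epsilon> * real n ^ 2 * real (card S))" (is "_ \<le> _ * (?A + ?B)")
    if "prime l" "S \<subseteq> carrier (residue_ring (int l))" and n: "n > 0" for l S n
  proof -
    have l: "l > 0" using that(1) prime_gt_0_nat by blast
    have S: "S \<subseteq> {0..int l - 1}" using that(2) by (simp add: residue_ring_def)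
    have fin: "finite S" using S by (rule finite_subset) simp
    have A: "?A \<ge> 0" and B: "?B \<ge> 0" by auto
    have "real (num_solutions l S n) \<le> 24 * ?A + 48 * D * ?B"
    \<comment> \<open>For l <= 2 n the interval for c can cover residues repeatedly and the trivial
      count suffices; otherwise c is unique and the Fejer argument applies.\<close>
    proof (cases "l \<le> 2 * n")
      case True
      have "0 \<le> 48 * D * ?B" using D0 by (intro mult_nonneg_nonneg B) auto
      then show ?thesis
        using num_solutions_le_small_modulus[OF fin l True] A by linarith
    next
      case False
      \<comment> \<open>Monotonicity in m turns the divisor bound into a single constant for all
        frequencies below l.\<close>
      have Dl: "real (card {d. d dvd m}) \<le> D * real l powr \<epsilon>" if "0 < m" "m < l" for m
      proof -
        have "D * real m powr \<epsilon> \<le> D * real l powr \<epsilon>"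
          using that D0 assms by (intro mult_left_mono powr_mono2) auto
        then show ?thesis using D[OF that(1)] by linarith
      qed
      have "real (num_solutions l S n) \<le> 24 * ?A + 48 * (D * real l powr \<epsilon>) * real n ^ 2 * real (card S)"
        using False D0 by (intro num_solutions_le_large_modulus S n Dl) auto
      then show ?thesis by (simp add: mult_ac)
    qed
    also have "\<dots> \<le> (24 + 48 * D) * (?A + ?B)"
    proof -
      have "0 \<le> 48 * D * ?A" using D0 by (intro mult_nonneg_nonneg A) auto
      then show ?thesis using B by (simp only: distrib_left distrib_right)
    qed
    finally show ?thesis .
  qed
  moreover have "24 + 48 * D > 0" using D0 by simp
  ultimately show ?thesis by blast
qed

end
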